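(* Let $G$ be a topological rough group with rough identity element $e$ and topology $\tau$ on its upper approximation $\overline{G}$. If $\{e\}$ is closed in $(\overline{G},\tau)$, then $G$ (with the topology $\tau_G$ induced by $\tau$) is Hausdorff.
   Context: An approximation space $(U,R)$ is a non-empty set $U$ with an equivalence relation $R$; for $X\subset U$ the upper approximation is $\overline{X}=\{x\in U:[x]_R\cap X\neq\emptyset\}$, where $[x]_R$ is the equivalence class of $x$. Let $U$ carry a binary operation, written $xy$. A subset $G\subset U$ is a rough group if: (1) $xy\in\overline{G}$ for all $x,y\in G$; (2) $(xy)z=x(yz)$ for all $x,y,z\in\overline{G}$; (3) there is $e\in\overline{G}$ (the rough identity element, not necessarily in $G$) with $ex=xe=x$ for all $x\in\overline{G}$; (4) for every $x\in G$ there is $y\in G$ with $xy=yx=e$ (written $y=x^{-1}$). A topological rough group is a rough group $G$ together with a topology $\tau$ on $\overline{G}$ such that, with $\tau_G$ the subspace topology on $G$, the multiplication $G\times G\to\overline{G}$, $(x,y)\mapsto xy$, is continuous (product topology of $\tau_G$ on $G\times G$, $\tau$ on $\overline{G}$) and the inverse mapping $G\to G$, $x\mapsto x^{-1}$, is continuous for $\tau_G$. *)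

theory Defs
  imports "HOL-Analysis.Analysis"
begin

locale approximation_space =
  fixes U :: "'a set" and R :: "('a \<times> 'a) set"
  assumes nonempty: "U \<noteq> {}"
    and equiv: "equiv U R"
begin

definition upper :: "'a set \<Rightarrow> 'a set" where
  "upper X = {x \<in> U. R `` {x} \<inter> X \<noteq> {}}"

lemma subset_upper: "X \<subseteq> U \<Longrightarrow> X \<subseteq> upper X"
  using equiv_class_self[OF equiv] by (auto simp: upper_def)

end

text \<open>
  The rough identity element \<open>e\<close> is a parameter of the locale. It is determined by the
  remaining parameters: see \<open>rough_identity_unique\<close> below.
\<close>

locale rough_group = approximation_space U R
  for U :: "'a set" and R :: "('a \<times> 'a) set" +
  fixes mult :: "'a \<Rightarrow> 'a \<Rightarrow> 'a" (infixl "\<cdot>" 70)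
    and G :: "'a set"
    and e :: 'a
  assumes mult_closed: "x \<in> U \<Longrightarrow> y \<in> U \<Longrightarrow> x \<cdot> y \<in> U"
    and G_subset: "G \<subseteq> U"
    and mult_upper: "x \<in> G \<Longrightarrow> y \<in> G \<Longrightarrow> x \<cdot> y \<in> upper G"
    and assoc: "x \<in> upper G \<Longrightarrow> y \<in> upper G \<Longrightarrow> z \<in> upper G \<Longrightarrow> (x \<cdot> y) \<cdot> z = x \<cdot> (y \<cdot> z)"
    and e_upper: "e \<in> upper G"
    and e_left: "x \<in> upper G \<Longrightarrow> e \<cdot> x = x"
    and e_right: "x \<in> upper G \<Longrightarrow> x \<cdot> e = x"
    and ex_inverse: "x \<in> G \<Longrightarrow> \<exists>y\<in>G. x \<cdot> y = e \<and> y \<cdot> x = e"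
begin

lemma rough_identity_unique:
  assumes "e' \<in> upper G" and "\<And>x. x \<in> upper G \<Longrightarrow> e' \<cdot> x = x \<and> x \<cdot> e' = x"
  shows "e' = e"
  using assms e_upper e_left by metis

lemma ex1_inverse:
  assumes "x \<in> G"
  shows "\<exists>!y. y \<in> G \<and> x \<cdot> y = e \<and> y \<cdot> x = e"
proof (rule ex_ex1I)
  show "\<exists>y. y \<in> G \<and> x \<cdot> y = e \<and> y \<cdot> x = e"
    using ex_inverse[OF assms] by blast
next
  fix y z
  assume y: "y \<in> G \<and> x \<cdot> y = e \<and> y \<cdot> x = e" and z: "z \<in> G \<and> x \<cdot> z = e \<and> z \<cdot> x = e"
  then have "x \<in> upper G" "y \<in> upper G" "z \<in> upper G"
    using assms subset_upper[OF G_subset] by auto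
  then show "y = z"
    using y z assoc[of y x z] e_left e_right by simp
qed

definition rough_inverse :: "'a \<Rightarrow> 'a" where
  "rough_inverse x = (THE y. y \<in> G \<and> x \<cdot> y = e \<and> y \<cdot> x = e)"

lemma rough_inverse:
  assumes "x \<in> G"
  shows "rough_inverse x \<in> G" and "x \<cdot> rough_inverse x = e" and "rough_inverse x \<cdot> x = e"
  using theI'[OF ex1_inverse[OF assms]] by (simp_all add: rough_inverse_def)

end

locale topological_rough_group = rough_group U R mult G e
  for U :: "'a set" and R :: "('a \<times> 'a) set"
    and mult :: "'a \<Rightarrow> 'a \<Rightarrow> 'a" (infixl "\<cdot>" 70)
    and G :: "'a set" and e :: 'a +
  fixes \<tau> :: "'a topology"
  assumes topspace: "topspace \<tau> = upper G"
    and continuous_mult: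
      "continuous_map (prod_topology (subtopology \<tau> G) (subtopology \<tau> G)) \<tau> (\<lambda>(x, y). x \<cdot> y)"
    and continuous_inverse:
      "continuous_map (subtopology \<tau> G) (subtopology \<tau> G) rough_inverse"

end

theory Submission imports Defs begin

text \<open>
  The map \<open>(x, y) \<mapsto> x\<inverse> y\<close> from \<open>G \<times> G\<close> to the upper approximation is
  continuous, and the preimage of \<open>{e}\<close> under it is the diagonal. So the diagonal is closed.
\<close>

context rough_group
begin

text \<open>Products may leave \<open>G\<close>, and associativity is given only on
  \<open>upper G\<close>. Cancelling is still possible because \<open>x\<close>,
  \<open>rough_inverse x\<close> and \<open>y\<close> lie in \<open>G\<close>, hence in
  \<open>upper G\<close>.\<close>

lemma rough_inverse_mult_eq_e_iff:
  assumes "x \<in> G" "y \<in> G"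
  shows "rough_inverse x \<cdot> y = e \<longleftrightarrow> x = y"
proof
  have upper: "x \<in> upper G" "y \<in> upper G" "rough_inverse x \<in> upper G"
    using assms rough_inverse(1) subset_upper[OF G_subset] by auto
  assume "rough_inverse x \<cdot> y = e"
  \<comment> \<open>The two bracketings of \<open>x \<cdot> rough_inverse x \<cdot> y\<close>
    evaluate to \<open>e \<cdot> y = y\<close> and \<open>x \<cdot> e = x\<close>.\<close>
  then show "x = y"
    using assoc[of x "rough_inverse x" y] upper rough_inverse(2)[OF assms(1)] e_left e_right
    by simp
next
  assume "x = y"
  then show "rough_inverse x \<cdot> y = e"
    using rough_inverse(3)[OF assms(1)] by simp
qed

end

context topological_rough_group
begin

text \<open>Inversion is continuous from \<open>G\<close> into \<open>G\<close>, so inverting the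
  first coordinate maps the product space to itself, and multiplication can be composed with
  it.\<close>

lemma continuous_rough_inverse_mult:
  "continuous_map (prod_topology (subtopology \<tau> G) (subtopology \<tau> G)) \<tau>
    (\<lambda>(x, y). rough_inverse x \<cdot> y)"
proof -
  let ?G = "subtopology \<tau> G"
  have "continuous_map (prod_topology ?G ?G) ?G (rough_inverse \<circ> fst)"
    by (rule continuous_map_compose[OF continuous_map_fst continuous_inverse])
  then have "continuous_map (prod_topology ?G ?G) (prod_topology ?G ?G)
      (\<lambda>p. (rough_inverse (fst p), snd p))"
    by (intro continuous_map_pairedI continuous_map_snd) (simp add: o_def)
  from continuous_map_compose[OF this continuous_mult] show ?thesis
    by (simp add: o_def case_prod_unfold)
qed

lemma Hausdorff_space_if_closedin_e:
  assumes "closedin \<tau> {e}"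
  shows "Hausdorff_space (subtopology \<tau> G)"
proof -
  let ?G = "subtopology \<tau> G"
  have G: "topspace ?G = G"
    using topspace subset_upper[OF G_subset] by auto
  have "closedin (prod_topology ?G ?G)
      {p \<in> topspace (prod_topology ?G ?G). (\<lambda>(x, y). rough_inverse x \<cdot> y) p \<in> {e}}"
    by (rule closedin_continuous_map_preimage[OF continuous_rough_inverse_mult assms])
  also have "{p \<in> topspace (prod_topology ?G ?G). (\<lambda>(x, y). rough_inverse x \<cdot> y) p \<in> {e}} =
      (\<lambda>x. (x, x)) ` topspace ?G"
    \<comment> \<open>Rewriting the carrier to \<open>G\<close> supplies the membership premises
      under which \<open>rough_inverse x \<cdot> y = e\<close> reduces to
      \<open>x = y\<close>.\<close>
    unfolding topspace_prod_topology G by (auto simp: rough_inverse_mult_eq_e_iff)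
  finally show ?thesis
    unfolding Hausdorff_space_closedin_diagonal .
qed

end

theorem theorem3p9:
  fixes U :: "'a set" and R :: "('a \<times> 'a) set"
    and mult :: "'a \<Rightarrow> 'a \<Rightarrow> 'a" and G :: "'a set" and e :: 'a
    and \<tau> :: "'a topology"
  assumes "topological_rough_group U R mult G e \<tau>"
    and "closedin \<tau> {e}"
  shows "Hausdorff_space (subtopology \<tau> G)"
  using assms by (rule topological_rough_group.Hausdorff_space_if_closedin_e)

end
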